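(* Let $A=\mathbb{C}[x,y,z]/(x^2+y^2+z^2-1)$, let $$P=\begin{pmatrix}x&y+iz\\ y-iz&-x\end{pmatrix},\qquad M=\tfrac12(P+I),$$ so that $M\in\operatorname{End}_A(A^2)$ is idempotent, and let $L=\ker(M)\cong A^2/\operatorname{im}(M)$, a projective $A$-module of rank one. Then $L$ has no flat algebraic connection: there is no connection $\nabla:\operatorname{Der}_{\mathbb{C}}(A)\to\operatorname{End}_{\mathbb{C}}(L)$ with curvature identically zero.
   Context: A connection on an $A$-module $L$ is an $A$-linear map $\nabla:\operatorname{Der}_{\mathbb{C}}(A)\to\operatorname{End}_{\mathbb{C}}(L)$ with $\nabla(\delta)(ae)=a\nabla(\delta)(e)+\delta(a)e$ for all $\delta\in\operatorname{Der}_{\mathbb C}(A)$, $a\in A$, $e\in L$. It is flat if $[\nabla(\delta),\nabla(\eta)]-\nabla([\delta,\eta])=0$ for all $\delta,\eta$. *)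

theory Defs
  imports "HOL-Analysis.Analysis" "HOL-Computational_Algebra.Polynomial"
begin

section \<open>Derivations and connections over a commutative complex algebra\<close>

text \<open>
  A commutative complex algebra is a commutative ring \<open>'a\<close> together with its structure map
  \<open>\<iota> :: complex \<Rightarrow> 'a\<close>; an \<open>'a\<close>-module is a type \<open>'l\<close> with a scalar multiplication
  \<open>sc :: 'a \<Rightarrow> 'l \<Rightarrow> 'l\<close>, on which the complex numbers act through \<open>\<iota>\<close>.
\<close>

definition derivations :: "(complex \<Rightarrow> 'a::comm_ring_1) \<Rightarrow> ('a \<Rightarrow> 'a) set" where
  "derivations \<iota> =
     {\<delta>. Vector_Spaces.linear (\<lambda>c a. \<iota> c * a) (\<lambda>c a. \<iota> c * a) \<delta> \<and>
         (\<forall>a b. \<delta> (a * b) = a * \<delta> b + \<delta> a * b)}"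

text \<open>
  Only the values of \<open>D\<close> on derivations matter: on other functions it is unconstrained.
\<close>

definition connection ::
  "(complex \<Rightarrow> 'a::comm_ring_1) \<Rightarrow> ('a \<Rightarrow> 'l::ab_group_add \<Rightarrow> 'l) \<Rightarrow> (('a \<Rightarrow> 'a) \<Rightarrow> 'l \<Rightarrow> 'l) \<Rightarrow> bool"
where
  "connection \<iota> sc D \<longleftrightarrow>
     (\<forall>\<delta>\<in>derivations \<iota>. Vector_Spaces.linear (\<lambda>c. sc (\<iota> c)) (\<lambda>c. sc (\<iota> c)) (D \<delta>)) \<and>
     (\<forall>\<delta>\<in>derivations \<iota>. \<forall>\<eta>\<in>derivations \<iota>. \<forall>e. D (\<lambda>b. \<delta> b + \<eta> b) e = D \<delta> e + D \<eta> e) \<and>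
     (\<forall>\<delta>\<in>derivations \<iota>. \<forall>a e. D (\<lambda>b. a * \<delta> b) e = sc a (D \<delta> e)) \<and>
     (\<forall>\<delta>\<in>derivations \<iota>. \<forall>a e. D \<delta> (sc a e) = sc a (D \<delta> e) + sc (\<delta> a) e)"

definition curvature ::
  "(('a \<Rightarrow> 'a) \<Rightarrow> 'l \<Rightarrow> 'l) \<Rightarrow> ('a::comm_ring_1 \<Rightarrow> 'a) \<Rightarrow> ('a \<Rightarrow> 'a) \<Rightarrow> 'l::ab_group_add \<Rightarrow> 'l"
where
  "curvature D \<delta> \<eta> e =
     (D \<delta> (D \<eta> e) - D \<eta> (D \<delta> e)) - D (\<lambda>a. \<delta> (\<eta> a) - \<eta> (\<delta> a)) e"

definition flat ::
  "(complex \<Rightarrow> 'a::comm_ring_1) \<Rightarrow> (('a \<Rightarrow> 'a) \<Rightarrow> 'l::ab_group_add \<Rightarrow> 'l) \<Rightarrow> bool"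
where
  "flat \<iota> D \<longleftrightarrow>
     (\<forall>\<delta>\<in>derivations \<iota>. \<forall>\<eta>\<in>derivations \<iota>. \<forall>e. curvature D \<delta> \<eta> e = 0)"


section \<open>The coordinate ring of the complex 2-sphere\<close>

text \<open>
  The polynomial ring in \<open>x\<close>, \<open>y\<close>, \<open>z\<close> is rendered as the iterated ring of univariate
  polynomials, with \<open>x\<close> the innermost and \<open>z\<close> the outermost variable.
\<close>

definition X_poly :: "complex poly poly poly" where "X_poly = [:[:[:0, 1:]:]:]"
definition Y_poly :: "complex poly poly poly" where "Y_poly = [:[:0, 1:]:]"
definition Z_poly :: "complex poly poly poly" where "Z_poly = [:0, 1:]"

definition sphere_poly :: "complex poly poly poly" where
  "sphere_poly = X_poly^2 + Y_poly^2 + Z_poly^2 - 1"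

definition sphere_rel :: "complex poly poly poly \<Rightarrow> complex poly poly poly \<Rightarrow> bool" where
  "sphere_rel p q \<longleftrightarrow> sphere_poly dvd p - q"

quotient_type sphere_ring = "complex poly poly poly" / sphere_rel
proof (intro equivpI reflpI sympI transpI)
  show "sphere_rel p p" for p by (simp add: sphere_rel_def)
  show "sphere_rel q p" if "sphere_rel p q" for p q
    using that unfolding sphere_rel_def by (metis dvd_minus_iff minus_diff_eq)
  show "sphere_rel p r" if "sphere_rel p q" "sphere_rel q r" for p q r
    using dvd_add[of sphere_poly "p - q" "q - r"] that by (simp add: sphere_rel_def)
qed

lemma not_sphere_poly_dvd_1: "\<not> sphere_poly dvd 1"
proof -
  have "sphere_poly = [:[:[:-1, 0, 1:], 0, 1:], 0, 1:]"
    by (simp add: sphere_poly_def X_poly_def Y_poly_def Z_poly_def power2_eq_square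
        one_pCons)
  thus ?thesis by (metis is_unit_poly_iff pCons_eq_iff pCons_eq_0_iff zero_neq_one)
qed

instantiation sphere_ring :: comm_ring_1
begin

lift_definition zero_sphere_ring :: sphere_ring is 0 .

lift_definition one_sphere_ring :: sphere_ring is 1 .

lift_definition plus_sphere_ring :: "sphere_ring \<Rightarrow> sphere_ring \<Rightarrow> sphere_ring" is "(+)"
  unfolding sphere_rel_def by (metis add_diff_add dvd_add)

lift_definition uminus_sphere_ring :: "sphere_ring \<Rightarrow> sphere_ring" is uminus
proof -
  fix p q :: "complex poly poly poly"
  assume "sphere_rel p q"
  hence "sphere_poly dvd - (p - q)" unfolding sphere_rel_def by (simp only: dvd_minus_iff)
  thus "sphere_rel (- p) (- q)" by (simp add: sphere_rel_def)
qed

lift_definition minus_sphere_ring :: "sphere_ring \<Rightarrow> sphere_ring \<Rightarrow> sphere_ring" is "(-)"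
proof -
  fix p q r s :: "complex poly poly poly"
  assume "sphere_rel p q" "sphere_rel r s"
  hence "sphere_poly dvd (p - q) - (r - s)" unfolding sphere_rel_def by (rule dvd_diff)
  thus "sphere_rel (p - r) (q - s)" by (simp add: sphere_rel_def algebra_simps)
qed

lift_definition times_sphere_ring :: "sphere_ring \<Rightarrow> sphere_ring \<Rightarrow> sphere_ring" is "(*)"
proof -
  fix p q r s :: "complex poly poly poly"
  assume "sphere_rel p q" "sphere_rel r s"
  hence "sphere_poly dvd (p - q) * r + q * (r - s)" by (simp add: sphere_rel_def)
  thus "sphere_rel (p * r) (q * s)" by (simp add: sphere_rel_def algebra_simps)
qed

instance
proof
  fix a b c :: sphere_ring
  show "a + b + c = a + (b + c)" "a + b = b + a" "0 + a = a" "- a + a = 0" "a - b = a + - b"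
    "a * b * c = a * (b * c)" "a * b = b * a" "1 * a = a" "(a + b) * c = a * c + b * c"
    by (transfer, simp add: sphere_rel_def algebra_simps)+
  show "(0 :: sphere_ring) \<noteq> 1"
    by transfer (simp add: sphere_rel_def not_sphere_poly_dvd_1)
qed

end

lift_definition const :: "complex \<Rightarrow> sphere_ring" is "\<lambda>c. [:[:[:c:]:]:]" .
lift_definition coord_x :: sphere_ring is X_poly .
lift_definition coord_y :: sphere_ring is Y_poly .
lift_definition coord_z :: sphere_ring is Z_poly .

lemma const_simps [simp]:
  "const 0 = 0" "const 1 = 1"
  "const (c + d) = const c + const d" "const (c * d) = const c * const d"
  by (transfer, simp add: sphere_rel_def one_pCons)+

lemma const_ii_squared: "const \<i> * const \<i> = -1"
  by transfer (simp add: sphere_rel_def one_pCons)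

lemma sphere_equation: "coord_x^2 + coord_y^2 + coord_z^2 = 1"
proof -
  have "coord_x * coord_x + coord_y * coord_y + coord_z * coord_z = 1"
    by transfer (simp add: sphere_rel_def sphere_poly_def power2_eq_square)
  thus ?thesis by (simp add: power2_eq_square)
qed


section \<open>The idempotent and the module \<open>L\<close>\<close>

definition mat_P :: "sphere_ring^2^2" where
  "mat_P = vector [vector [coord_x,               coord_y + const \<i> * coord_z],
               vector [coord_y - const \<i> * coord_z, - coord_x]]"

definition mat_M :: "sphere_ring^2^2" where
  "mat_M = (\<chi> i j. const (1/2) * (mat_P + mat 1) $ i $ j)"

lifting_forget sphere_ring.lifting

typedef L = "{v :: sphere_ring^2. mat_M *v v = 0}"
  morphisms vec_of_L L_of_vec
  by (rule exI[of _ 0]) (simp add: matrix_vector_mult_def vec_eq_iff)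

setup_lifting type_definition_L

instantiation L :: ab_group_add
begin
lift_definition zero_L :: L is 0 by (simp add: matrix_vector_mult_def vec_eq_iff)
lift_definition plus_L :: "L \<Rightarrow> L \<Rightarrow> L" is "(+)" by (simp add: matrix_vector_right_distrib)
lift_definition uminus_L :: "L \<Rightarrow> L" is uminus
  by (simp add: matrix_vector_mult_def vec_eq_iff sum_negf)
lift_definition minus_L :: "L \<Rightarrow> L \<Rightarrow> L" is "(-)"
  by (simp add: matrix_vector_mult_def vec_eq_iff right_diff_distrib sum_subtractf)
instance by standard (transfer, simp add: algebra_simps)+
end

lift_definition scale_L :: "sphere_ring \<Rightarrow> L \<Rightarrow> L" is "(*s)"
  by (simp add: matrix_vector_mult_def vec_eq_iff mult.left_commute flip: sum_distrib_left)


text \<open>The complex vector space structures occurring in the definitions above do exist.\<close>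

lemma vector_space_sphere_ring: "vector_space (\<lambda>c a. const c * a)"
  by unfold_locales (simp_all add: algebra_simps)

lemma module_vec: "module ((*s) :: sphere_ring \<Rightarrow> sphere_ring^2 \<Rightarrow> sphere_ring^2)"
  by unfold_locales (simp_all add: vec_eq_iff algebra_simps)

lemma module_L: "module scale_L"
  by unfold_locales (transfer, simp add: vec_eq_iff algebra_simps)+

lemma vector_space_L: "vector_space (\<lambda>c. scale_L (const c))"
proof -
  interpret module scale_L by (rule module_L)
  show ?thesis by unfold_locales (simp_all add: scale_right_distrib scale_left_distrib)
qed

lemma M_component:
  "mat_M $ 1 $ 1 = const (1/2) * (1 + coord_x)" "mat_M $ 1 $ 2 = const (1/2) * (coord_y + const \<i> * coord_z)"
  "mat_M $ 2 $ 1 = const (1/2) * (coord_y - const \<i> * coord_z)" "mat_M $ 2 $ 2 = const (1/2) * (1 - coord_x)"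
  by (simp_all add: mat_M_def mat_P_def mat_def algebra_simps)

lemma const_half: "const (1/2) + const (1/2) = 1"
  by (simp flip: const_simps)

lemma const_half_cancel: "const (1/2) * a = 0 \<longleftrightarrow> a = 0"
proof
  assume "const (1/2) * a = 0"
  hence "(const (1/2) + const (1/2)) * a = 0" by (simp only: distrib_right) simp
  thus "a = 0" by (simp add: const_half)
qed simp

lemma det_P_relation: "(coord_y + const \<i> * coord_z) * (coord_y - const \<i> * coord_z) = (1 + coord_x) * (1 - coord_x)"
proof -
  have "(coord_y + const \<i> * coord_z) * (coord_y - const \<i> * coord_z) = coord_y^2 - (const \<i> * const \<i>) * coord_z^2"
    by (simp add: algebra_simps power2_eq_square)
  also have "\<dots> = (coord_x^2 + coord_y^2 + coord_z^2) - coord_x^2" by (simp add: const_ii_squared)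
  also have "\<dots> = (1 + coord_x) * (1 - coord_x)"
    by (simp only: sphere_equation) (simp add: algebra_simps power2_eq_square)
  finally show ?thesis .
qed

lemma M_idempotent: "mat_M ** mat_M = mat_M"
proof -
  define h where "h = const (1/2)"
  define u where "u = coord_y + const \<i> * coord_z"
  define w where "w = coord_y - const \<i> * coord_z"
  have uw: "u * w = (1 + coord_x) * (1 - coord_x)" unfolding u_def w_def by (rule det_P_relation)
  have h: "h * (h * a) + h * (h * a) = h * a" for a
    using arg_cong[OF const_half, of "\<lambda>t. h * a * t"] by (simp add: h_def algebra_simps)
  have 1: "h * (1 + coord_x) * (h * (1 + coord_x)) + h * u * (h * w) = h * (1 + coord_x)"
  proof -
    have "h * (1 + coord_x) * (h * (1 + coord_x)) + h * u * (h * w) = h * h * ((1 + coord_x) * (1 + coord_x) + u * w)"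
      by (simp add: algebra_simps)
    also have "\<dots> = h * (h * (1 + coord_x)) + h * (h * (1 + coord_x))"
      unfolding uw by (simp add: algebra_simps)
    finally show ?thesis by (simp only: h)
  qed
  have 2: "h * (1 + coord_x) * (h * u) + h * u * (h * (1 - coord_x)) = h * u"
    using h[of u] by (simp add: algebra_simps)
  have 3: "h * w * (h * (1 + coord_x)) + h * (1 - coord_x) * (h * w) = h * w"
    using h[of w] by (simp add: algebra_simps)
  have 4: "h * w * (h * u) + h * (1 - coord_x) * (h * (1 - coord_x)) = h * (1 - coord_x)"
  proof -
    have "h * w * (h * u) + h * (1 - coord_x) * (h * (1 - coord_x)) = h * h * (u * w + (1 - coord_x) * (1 - coord_x))"
      by (simp add: algebra_simps)
    also have "\<dots> = h * (h * (1 - coord_x)) + h * (h * (1 - coord_x))"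
      unfolding uw by (simp add: algebra_simps)
    finally show ?thesis by (simp only: h)
  qed
  show ?thesis
    using 1 2 3 4 unfolding h_def u_def w_def
    by (simp add: vec_eq_iff forall_2 matrix_matrix_mult_def sum_2 M_component)
qed

lemma M_mult_M: "mat_M *v (mat_M *v v) = mat_M *v v"
  by (simp add: matrix_vector_mul_assoc M_idempotent)

lemma M_vec_diff: "mat_M *v (v - w) = mat_M *v v - mat_M *v w"
  by (simp add: matrix_vector_mult_def vec_eq_iff right_diff_distrib sum_subtractf)

lemma M_vec_scale: "mat_M *v (a *s v) = a *s (mat_M *v v)"
  by (simp add: matrix_vector_mult_def vec_eq_iff mult.left_commute flip: sum_distrib_left)

text \<open>\<open>L\<close> is isomorphic to \<open>A\<^sup>2 / im(mat_M)\<close>, and is a direct summand of \<open>A\<^sup>2\<close>, hence projective.\<close>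

lift_definition proj_L :: "sphere_ring^2 \<Rightarrow> L" is "\<lambda>v. v - mat_M *v v"
  by (simp add: M_vec_diff M_mult_M)

lemma proj_L_hom: "module_hom (*s) scale_L proj_L"
proof (intro module_hom.intro module_vec module_L module_hom_axioms.intro)
  show "proj_L (v + w) = proj_L v + proj_L w" for v w
    by transfer (simp add: matrix_vector_right_distrib)
  show "proj_L (a *s v) = scale_L a (proj_L v)" for a v
    by transfer (simp add: M_vec_scale vec_eq_iff right_diff_distrib)
qed

lemma vec_of_L_hom: "module_hom scale_L (*s) vec_of_L"
  by (intro module_hom.intro module_vec module_L module_hom_axioms.intro) (transfer, simp)+

lemma proj_L_vec_of_L: "proj_L (vec_of_L e) = e"
  by transfer simp

lemma L_cokernel: "surj proj_L" "{v. proj_L v = 0} = range ((*v) mat_M)"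
proof -
  show "surj proj_L" using proj_L_vec_of_L by (rule surjI)
  have "proj_L v = 0 \<longleftrightarrow> v = mat_M *v v" for v by transfer simp
  thus "{v. proj_L v = 0} = range ((*v) mat_M)" using M_mult_M by (auto simp: image_iff)
qed

text \<open>
  \<open>L\<close> has rank one: it becomes free on one generator after inverting \<open>1 + coord_x\<close> or \<open>1 - coord_x\<close>, and
  these two elements generate the unit ideal, as their sum is \<open>2\<close>.
\<close>

lemma L_iff:
  "mat_M *v v = 0 \<longleftrightarrow> (1 + coord_x) * v $ 1 + (coord_y + const \<i> * coord_z) * v $ 2 = 0 \<and>
                 (coord_y - const \<i> * coord_z) * v $ 1 + (1 - coord_x) * v $ 2 = 0"
proof -
  have "mat_M *v v = 0 \<longleftrightarrow>
      const (1/2) * ((1 + coord_x) * v $ 1 + (coord_y + const \<i> * coord_z) * v $ 2) = 0 \<and>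
      const (1/2) * ((coord_y - const \<i> * coord_z) * v $ 1 + (1 - coord_x) * v $ 2) = 0"
    by (simp add: vec_eq_iff forall_2 matrix_vector_mult_def sum_2 M_component algebra_simps)
  thus ?thesis by (simp only: const_half_cancel)
qed

lemma L_locally_free_rank_one:
  assumes "f = 1 + coord_x \<or> f = 1 - coord_x"
  shows "\<exists>e. (\<forall>v. \<exists>a. scale_L f v = scale_L a e) \<and> (\<forall>a. scale_L a e = 0 \<longrightarrow> f * a = 0)"
  using assms
proof
  assume f: "f = 1 + coord_x"
  define e :: "sphere_ring^2" where "e = vector [- (coord_y + const \<i> * coord_z), 1 + coord_x]"
  have e: "mat_M *v e = 0" unfolding L_iff e_def
    using det_P_relation by (simp add: algebra_simps)
  have "f *s v = v $ 2 *s e" if "mat_M *v v = 0" for v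
  proof -
    have "(1 + coord_x) * v $ 1 = - ((coord_y + const \<i> * coord_z) * v $ 2)"
      using that unfolding L_iff by (simp only: eq_neg_iff_add_eq_0)
    thus ?thesis by (simp add: f e_def vec_eq_iff forall_2 algebra_simps)
  qed
  moreover have "f * a = 0" if "a *s e = 0" for a
    using that by (simp add: f e_def vec_eq_iff forall_2 mult.commute)
  ultimately show ?thesis using e by transfer blast
next
  assume f: "f = 1 - coord_x"
  define e :: "sphere_ring^2" where "e = vector [1 - coord_x, - (coord_y - const \<i> * coord_z)]"
  have e: "mat_M *v e = 0" unfolding L_iff e_def
    using det_P_relation by (simp add: algebra_simps)
  have "f *s v = v $ 1 *s e" if "mat_M *v v = 0" for v
  proof -
    have "(1 - coord_x) * v $ 2 = - ((coord_y - const \<i> * coord_z) * v $ 1)"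
      using that unfolding L_iff by (simp only: eq_neg_iff_add_eq_0 add.commute)
    thus ?thesis by (simp add: f e_def vec_eq_iff forall_2 algebra_simps)
  qed
  moreover have "f * a = 0" if "a *s e = 0" for a
    using that by (simp add: f e_def vec_eq_iff forall_2 mult.commute)
  ultimately show ?thesis using e by transfer blast
qed

end

theory Submission
  imports Defs
begin

text \<open>
  The curvature class of \<open>L\<close> is a nonzero multiple of the class of the area form of the sphere, and
  the area form is not exact on the affine quadric; a flat connection would make it exact.
  
  Let \<open>Q = 1 - M\<close> be the projection of \<open>A\<^sup>2\<close> onto \<open>L\<close>. A connection on \<open>L\<close> is described by
  the matrices \<open>A(\<delta>)\<close> whose columns are the images under \<open>\<nabla>(\<delta>)\<close> of the two generators of \<open>L\<close>
  given by the columns of \<open>Q\<close>. The trace \<open>f(\<delta>) = tr A(\<delta>)\<close> is an algebraic one-form. If the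
  connection is flat, then the exterior derivative of \<open>f\<close> is minus the trace of the curvature of the
  Grassmann connection \<open>Q \<circ> \<delta>\<close> (\<open>trace_conn_mat_of_flat\<close>), and a computation with the \<open>2 \<times> 2\<close> matrix
  \<open>Q\<close> shows that this is \<open>-\<i>/2\<close> times the area form
  \<open>(\<delta>, \<eta>) \<mapsto> det (n, \<delta> n, \<eta> n)\<close>, with \<open>n = (x, y, z)\<close> (\<open>trace_curvature_proj_mat\<close>).
  
  To see that no one-form has this derivative, evaluate on the rotation fields
  \<open>R\<^sub>x = y \<partial>\<^sub>z - z \<partial>\<^sub>y\<close>, \<open>R\<^sub>y = z \<partial>\<^sub>x - x \<partial>\<^sub>z\<close>, \<open>R\<^sub>z = x \<partial>\<^sub>y - y \<partial>\<^sub>x\<close>.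
  They satisfy \<open>[R\<^sub>x, R\<^sub>y] = - R\<^sub>z\<close> (and cyclically) and \<open>x R\<^sub>x + y R\<^sub>y + z R\<^sub>z = 0\<close>, and the area
  form takes the values \<open>z\<close>, \<open>x\<close>, \<open>y\<close> on the pairs \<open>(R\<^sub>x, R\<^sub>y)\<close>, \<open>(R\<^sub>y, R\<^sub>z)\<close>, \<open>(R\<^sub>z, R\<^sub>x)\<close>.
  Multiplying these three values by \<open>z\<close>, \<open>x\<close>, \<open>y\<close> and adding gives \<open>1\<close>; on the side of \<open>f\<close> the same
  combination is a sum of three elements of the form \<open>R\<^sub>x a\<close>, \<open>R\<^sub>y b\<close>, \<open>R\<^sub>z c\<close>. Such a sum cannot be
  a nonzero constant, because the mean value over the unit sphere is a linear functional on \<open>A\<close> that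
  kills the images of all rotations and sends a constant to itself. This functional is defined
  algebraically here, by the well-known moments of the coordinates; its invariance then reduces to
  recursions for these moments (\<open>poly_mean_sphere\<close>, \<open>poly_mean_rotation\<close>).
\<close>

section \<open>Rules for derivations\<close>

lemma derivation_add: "\<delta> \<in> derivations \<iota> \<Longrightarrow> \<delta> (a + b) = \<delta> a + \<delta> b"
  by (simp add: derivations_def Vector_Spaces.linear_iff)

lemma derivation_scale: "\<delta> \<in> derivations \<iota> \<Longrightarrow> \<delta> (\<iota> c * a) = \<iota> c * \<delta> a"
  unfolding derivations_def Vector_Spaces.linear_iff by blast

lemma derivation_mult: "\<delta> \<in> derivations \<iota> \<Longrightarrow> \<delta> (a * b) = a * \<delta> b + \<delta> a * b"
  by (simp add: derivations_def)

lemma derivation_0: "\<delta> \<in> derivations \<iota> \<Longrightarrow> \<delta> 0 = 0"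
  using derivation_add[of \<delta> \<iota> 0 0] by simp

lemma derivation_1: "\<delta> \<in> derivations \<iota> \<Longrightarrow> \<delta> 1 = 0"
  using derivation_mult[of \<delta> \<iota> 1 1] by simp

lemma derivation_minus: "\<delta> \<in> derivations \<iota> \<Longrightarrow> \<delta> (- a) = - \<delta> a"
  using derivation_add[of \<delta> \<iota> a "- a"] by (simp add: derivation_0 eq_neg_iff_add_eq_0 add.commute)

lemma derivation_diff: "\<delta> \<in> derivations \<iota> \<Longrightarrow> \<delta> (a - b) = \<delta> a - \<delta> b"
  using derivation_add[of \<delta> \<iota> a "- b"] by (simp add: derivation_minus)

lemma derivation_sum: "\<delta> \<in> derivations \<iota> \<Longrightarrow> \<delta> (sum f S) = (\<Sum>i\<in>S. \<delta> (f i))"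
  by (induction S rule: infinite_finite_induct) (simp_all add: derivation_0 derivation_add)

lemma derivations_add:
  assumes "\<delta> \<in> derivations \<iota>" "\<eta> \<in> derivations \<iota>"
  shows "(\<lambda>b. \<delta> b + \<eta> b) \<in> derivations \<iota>"
  using assms by (auto simp: derivations_def Vector_Spaces.linear_iff algebra_simps)

lemma derivations_smult:
  assumes "\<delta> \<in> derivations \<iota>"
  shows "(\<lambda>b. a * \<delta> b) \<in> derivations \<iota>"
  using assms by (auto simp: derivations_def Vector_Spaces.linear_iff algebra_simps)

lemma commutator_derivation:
  assumes "\<delta> \<in> derivations \<iota>" "\<eta> \<in> derivations \<iota>"
  shows "(\<lambda>a. \<delta> (\<eta> a) - \<eta> (\<delta> a)) \<in> derivations \<iota>"
proof -
  let ?\<kappa> = "\<lambda>a. \<delta> (\<eta> a) - \<eta> (\<delta> a)"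
  note add = assms[THEN derivation_add] and scale = assms[THEN derivation_scale]
    and mult = assms[THEN derivation_mult]
  have "vector_space (\<lambda>c a. \<iota> c * a)"
    using assms(1) unfolding derivations_def Vector_Spaces.linear_iff by blast
  moreover have "?\<kappa> (a + b) = ?\<kappa> a + ?\<kappa> b" for a b
    by (simp add: add)
  moreover have "?\<kappa> (\<iota> c * a) = \<iota> c * ?\<kappa> a" for c a
    by (simp add: scale right_diff_distrib)
  moreover have "?\<kappa> (a * b) = a * ?\<kappa> b + ?\<kappa> a * b" for a b
    by (simp add: add mult algebra_simps)
  ultimately show ?thesis
    unfolding derivations_def Vector_Spaces.linear_iff by blast
qed

section \<open>The trace of a connection on the image of an idempotent\<close>

lemma trace_derivation: "\<delta> \<in> derivations \<iota> \<Longrightarrow> trace (map_matrix \<delta> A) = \<delta> (trace A)"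
  by (simp add: trace_def derivation_sum)

lemma map_matrix_derivation_mult:
  "\<delta> \<in> derivations \<iota> \<Longrightarrow> map_matrix \<delta> (A ** B) = A ** map_matrix \<delta> B + map_matrix \<delta> A ** B"
  by (simp add: vec_eq_iff matrix_matrix_mult_def derivation_sum derivation_mult sum.distrib)

lemma matrix_add_rdistrib: "(A + B) ** C = A ** C + B ** C"
  for A B :: "'a::semiring_1^'n^'m"
  by (simp add: vec_eq_iff matrix_matrix_mult_def sum.distrib distrib_right)

text \<open>
  The traces that occur in the curvature equation of a connection matrix. Here \<open>A\<close> stands for the
  connection matrix in the direction of another derivation \<open>\<eta>\<close> and \<open>B\<close> for \<open>\<eta> Q\<close>; the hypotheses say
  that the columns of \<open>A\<close> lie in the image of \<open>Q\<close> and that \<open>A\<close> respects the relations between the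
  columns of \<open>Q\<close>. By the Leibniz rule the two sides differ by \<open>tr (\<delta>Q A) - tr (\<delta>Q Q B)\<close>. Substituting
  \<open>A = Q A\<close> and then the last hypothesis, this is \<open>tr (Q \<delta>Q Q A)\<close>, and \<open>Q \<delta>Q Q = 0\<close> for every
  idempotent \<open>Q\<close>.
\<close>
lemma trace_derivation_of_connection_matrix:
  fixes Q A :: "'a::comm_ring_1^'n^'n"
  assumes \<delta>: "\<delta> \<in> derivations \<iota>"
    and Q: "Q ** Q = Q"
    and QA: "Q ** A = A"
    and A: "A = Q ** B + A ** Q"
  shows "trace (Q ** map_matrix \<delta> A) = \<delta> (trace A) - trace (map_matrix \<delta> Q ** Q ** B)"
proof -
  let ?Q = "map_matrix \<delta> Q"
  have "?Q = Q ** ?Q + ?Q ** Q"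
    using map_matrix_derivation_mult[OF \<delta>, of Q Q] Q by simp
  hence "?Q ** Q = (Q ** ?Q + ?Q ** Q) ** Q" by simp
  hence "Q ** ?Q ** Q = 0"
    by (simp add: matrix_add_rdistrib matrix_mul_assoc[symmetric] Q)
  hence "trace (?Q ** Q ** (A ** Q)) = 0"
    by (metis matrix_mul_assoc trace_mul_sym trace_0 mat_0 times0_left)
  hence "trace (?Q ** A) = trace (?Q ** Q ** B)"
    using arg_cong[OF A, of "\<lambda>T. trace (?Q ** Q ** T)"]
    by (simp add: matrix_add_ldistrib trace_add matrix_mul_assoc[symmetric] QA)
      (simp add: matrix_mul_assoc Q)
  moreover have "\<delta> (trace A) = trace (Q ** map_matrix \<delta> A) + trace (?Q ** A)"
    by (metis QA \<delta> map_matrix_derivation_mult trace_add trace_derivation)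
  ultimately show ?thesis by simp
qed

definition proj_mat :: "sphere_ring^2^2" where "proj_mat = mat 1 - mat_M"

text \<open>
  The two elements \<open>proj_L (axis j 1)\<close> generate \<open>L\<close> and satisfy relations, so the coordinates of
  \<open>D \<delta> (proj_L (axis j 1))\<close> in them are not unique; this definition takes those given by the
  inclusion of \<open>L\<close> in \<open>A\<^sup>2\<close>.
\<close>
definition conn_mat :: "('d \<Rightarrow> L \<Rightarrow> L) \<Rightarrow> 'd \<Rightarrow> sphere_ring^2^2" where
  "conn_mat D \<delta> = (\<chi> k j. vec_of_L (D \<delta> (proj_L (axis j 1))) $ k)"

lemma vec_of_L_proj_L: "vec_of_L (proj_L v) = proj_mat *v v"
  by (simp add: proj_L.rep_eq proj_mat_def matrix_vector_mult_diff_rdistrib)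

lemma proj_mat_vec_of_L: "proj_mat *v vec_of_L e = vec_of_L e"
  by (metis proj_L_vec_of_L vec_of_L_proj_L)

lemma column_mult: "column j (A ** B) = A *v column j B"
  by (simp add: column_def matrix_matrix_mult_def matrix_vector_mult_def)

lemma matrix_eq_columns: "A = B \<longleftrightarrow> (\<forall>j. column j A = column j B)"
  by (auto simp: column_def vec_eq_iff)

lemma column_eq_mult_axis: "column j A = A *v axis j 1"
  for A :: "'a::comm_semiring_1^'n^'m"
  by (simp add: column_def vec_eq_iff matrix_vector_mult_def axis_def if_distrib cong: if_cong)

lemma column_conn_mat: "column j (conn_mat D \<delta>) = vec_of_L (D \<delta> (proj_L (axis j 1)))"
  by (simp add: column_def conn_mat_def vec_eq_iff)

lemma proj_mat_idempotent: "proj_mat ** proj_mat = proj_mat"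
  by (simp add: matrix_eq_columns column_mult column_eq_mult_axis[of _ proj_mat]
     flip: vec_of_L_proj_L) (simp add: proj_L_vec_of_L)

lemma proj_mat_conn_mat: "proj_mat ** conn_mat D \<delta> = conn_mat D \<delta>"
  by (simp add: matrix_eq_columns column_mult column_conn_mat proj_mat_vec_of_L)

text \<open>
  In the coordinates of \<open>A\<^sup>2\<close> the connection is \<open>Q \<circ> \<delta>\<close> plus its matrix, by the Leibniz rule applied
  to \<open>v = v\<^sub>1 e\<^sub>1 + v\<^sub>2 e\<^sub>2\<close>.
\<close>
lemma vec_of_connection_proj_L:
  assumes D: "connection const scale_L D" and \<delta>: "\<delta> \<in> derivations const"
  shows "vec_of_L (D \<delta> (proj_L v)) = proj_mat *v (\<chi> k. \<delta> (v $ k)) + conn_mat D \<delta> *v v"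
proof -
  interpret module_hom "(*s)" scale_L proj_L by (rule proj_L_hom)
  have v: "v = v $ 1 *s axis 1 1 + v $ 2 *s axis 2 1"
    by (simp add: vec_eq_iff forall_2 axis_def)
  have D_add: "D \<delta> (e + e') = D \<delta> e + D \<delta> e'" for e e'
    using D \<delta> by (simp add: connection_def Vector_Spaces.linear_iff)
  have D_scale: "D \<delta> (scale_L a e) = scale_L a (D \<delta> e) + scale_L (\<delta> a) e" for a e
    using D \<delta> by (simp add: connection_def)
  have *: "vec_of_L (D \<delta> (proj_L (a *s axis j 1))) =
      a *s column j (conn_mat D \<delta>) + \<delta> a *s column j proj_mat" for a j
    by (simp add: scale D_scale plus_L.rep_eq scale_L.rep_eq column_conn_mat vec_of_L_proj_L
        column_eq_mult_axis[of _ proj_mat])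
  have "vec_of_L (D \<delta> (proj_L v)) =
     vec_of_L (D \<delta> (proj_L (v $ 1 *s axis 1 1))) + vec_of_L (D \<delta> (proj_L (v $ 2 *s axis 2 1)))"
    by (subst v) (simp add: add D_add plus_L.rep_eq)
  also have "\<dots> = proj_mat *v (\<chi> k. \<delta> (v $ k)) + conn_mat D \<delta> *v v"
    unfolding * by (simp add: vec_eq_iff forall_2 matrix_vector_mult_def sum_2 column_def algebra_simps)
  finally show ?thesis .
qed

lemma vec_of_connection:
  assumes D: "connection const scale_L D" and \<delta>: "\<delta> \<in> derivations const"
  shows "vec_of_L (D \<delta> e) = proj_mat *v (\<chi> k. \<delta> (vec_of_L e $ k)) + conn_mat D \<delta> *v vec_of_L e"
  using vec_of_connection_proj_L[OF assms, of "vec_of_L e"] by (simp add: proj_L_vec_of_L)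

lemma column_map_matrix: "column j (map_matrix \<delta> A) = (\<chi> k. \<delta> (column j A $ k))"
  by (simp add: column_def vec_eq_iff)

lemma column_add: "column j (A + B) = column j A + column j B"
  by (simp add: column_def vec_eq_iff)

lemma column_diff: "column j (A - B) = column j A - column j B"
  by (simp add: column_def vec_eq_iff)

text \<open>
  The columns of \<open>Q\<close> are the generators of \<open>L\<close> written in \<open>A\<^sup>2\<close>. Computing \<open>D \<delta>\<close> of a generator from
  this expression, instead of reading it off, yields this compatibility.
\<close>
lemma conn_mat_Leibniz:
  assumes D: "connection const scale_L D" and \<delta>: "\<delta> \<in> derivations const"
  shows "conn_mat D \<delta> = proj_mat ** map_matrix \<delta> proj_mat + conn_mat D \<delta> ** proj_mat"
  unfolding matrix_eq_columns column_add column_mult column_map_matrix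
  by (simp add: column_conn_mat[of _ D \<delta>] vec_of_connection[OF D \<delta>] vec_of_L_proj_L
      column_eq_mult_axis[of _ proj_mat])

text \<open>
  The flatness equation reads \<open>Q \<delta>A(\<eta>) + A(\<delta>) A(\<eta>) - Q \<eta>A(\<delta>) - A(\<eta>) A(\<delta>) = A([\<delta>, \<eta>])\<close>. Under the
  trace the products of connection matrices cancel, and only the exterior derivative of the trace
  and terms in \<open>Q\<close> remain.
\<close>
lemma trace_conn_mat_of_flat:
  assumes D: "connection const scale_L D" and flat: "flat const D"
    and \<delta>: "\<delta> \<in> derivations const" and \<eta>: "\<eta> \<in> derivations const"
  defines "f \<equiv> \<lambda>\<delta>. trace (conn_mat D \<delta>)"
  shows "\<delta> (f \<eta>) - \<eta> (f \<delta>) - f (\<lambda>a. \<delta> (\<eta> a) - \<eta> (\<delta> a)) =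
    trace (map_matrix \<delta> proj_mat ** proj_mat ** map_matrix \<eta> proj_mat) -
    trace (map_matrix \<eta> proj_mat ** proj_mat ** map_matrix \<delta> proj_mat)"
proof -
  let ?A = "conn_mat D" and ?Q = proj_mat
  let ?\<kappa> = "\<lambda>a. \<delta> (\<eta> a) - \<eta> (\<delta> a)"
  have comp: "column j (?Q ** map_matrix \<delta> (?A \<eta>) + ?A \<delta> ** ?A \<eta>) =
      vec_of_L (D \<delta> (D \<eta> (proj_L (axis j 1))))"
    if "\<delta> \<in> derivations const" for \<delta> \<eta> j
    by (simp add: column_add column_mult column_map_matrix column_conn_mat vec_of_connection[OF D that])
  have "D \<delta> (D \<eta> e) - D \<eta> (D \<delta> e) = D ?\<kappa> e" for e
    using flat \<delta> \<eta> by (simp add: flat_def curvature_def)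
  hence "(?Q ** map_matrix \<delta> (?A \<eta>) + ?A \<delta> ** ?A \<eta>) - (?Q ** map_matrix \<eta> (?A \<delta>) + ?A \<eta> ** ?A \<delta>) = ?A ?\<kappa>"
    by (simp add: matrix_eq_columns column_diff comp \<delta> \<eta> column_conn_mat flip: minus_L.rep_eq)
  from arg_cong[OF this, of trace]
  have "trace (?Q ** map_matrix \<delta> (?A \<eta>)) - trace (?Q ** map_matrix \<eta> (?A \<delta>)) = f ?\<kappa>"
    by (simp add: trace_add trace_sub f_def trace_mul_sym[of "?A \<delta>" "?A \<eta>"])
  thus ?thesis
    unfolding trace_derivation_of_connection_matrix[OF \<delta> proj_mat_idempotent proj_mat_conn_mat conn_mat_Leibniz[OF D \<eta>]]
     trace_derivation_of_connection_matrix[OF \<eta> proj_mat_idempotent proj_mat_conn_mat conn_mat_Leibniz[OF D \<delta>]]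
    by (simp add: f_def algebra_simps)
qed

text \<open>
  The shape of \<open>Q = 1 - h (1 + P)\<close> and its derivatives \<open>S\<close> and \<open>T\<close>, where \<open>P\<close> is a general traceless
  \<open>2 \<times> 2\<close> matrix. The scalar part of \<open>Q\<close> drops out of the commutator, which leaves
  \<open>tr (P [T, S])\<close>, an alternating trilinear form in three traceless matrices and hence a multiple of
  their determinant in the coordinates \<open>x, u, w\<close>.
\<close>
lemma trace_commutator_2x2:
  fixes h x u w a p q b r s :: "'a::comm_ring_1"
  defines "Q \<equiv> vector [vector [1 - h * (1 + x), - (h * u)], vector [- (h * w), 1 - h * (1 - x)]] :: 'a^2^2"
  defines "S \<equiv> vector [vector [- (h * a), - (h * p)], vector [- (h * q), h * a]] :: 'a^2^2"
  defines "T \<equiv> vector [vector [- (h * b), - (h * r)], vector [- (h * s), h * b]] :: 'a^2^2"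
  shows "trace (S ** Q ** T) - trace (T ** Q ** S) =
    - 2 * h * h * h * (x * (q * r - p * s) + u * (a * s - b * q) + w * (b * p - a * r))"
  by (simp add: Q_def S_def T_def trace_def sum_2 matrix_matrix_mult_def)
     (simp add: algebra_simps)

lemma trace_curvature_proj_mat:
  assumes \<delta>: "\<delta> \<in> derivations const" and \<eta>: "\<eta> \<in> derivations const"
  shows "trace (map_matrix \<delta> proj_mat ** proj_mat ** map_matrix \<eta> proj_mat) -
    trace (map_matrix \<eta> proj_mat ** proj_mat ** map_matrix \<delta> proj_mat) =
    const (- \<i> / 2) *
      (coord_x * (\<delta> coord_y * \<eta> coord_z - \<delta> coord_z * \<eta> coord_y) +
       coord_y * (\<delta> coord_z * \<eta> coord_x - \<delta> coord_x * \<eta> coord_z) +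
       coord_z * (\<delta> coord_x * \<eta> coord_y - \<delta> coord_y * \<eta> coord_x))"
proof -
  define h i where "h = const (1/2)" and "i = const \<i>"
  have Q: "proj_mat = vector [vector [1 - h * (1 + coord_x), - (h * (coord_y + i * coord_z))],
      vector [- (h * (coord_y - i * coord_z)), 1 - h * (1 - coord_x)]]"
    by (simp add: vec_eq_iff forall_2 proj_mat_def M_component mat_def h_def i_def)
  have dQ: "map_matrix \<theta> proj_mat =
      vector [vector [- (h * \<theta> coord_x), - (h * (\<theta> coord_y + i * \<theta> coord_z))],
        vector [- (h * (\<theta> coord_y - i * \<theta> coord_z)), h * \<theta> coord_x]]"
    if \<theta>: "\<theta> \<in> derivations const" for \<theta>
    by (simp add: vec_eq_iff forall_2 Q h_def i_def derivation_add[OF \<theta>] derivation_diff[OF \<theta>]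
      derivation_1[OF \<theta>] derivation_minus[OF \<theta>] derivation_scale[OF \<theta>])
  \<comment> \<open>\<open>h\<^sup>3 = 1/8\<close>, one factor \<open>2\<close> comes from the trace form, and \<open>2 i\<close> is the determinant, up to
    sign, of the substitution \<open>u = y + i z\<close>, \<open>w = y - i z\<close>.\<close>
  have "- \<i> / 2 = - (1 + 1) * (1/2) * (1/2) * (1/2) * (1 + 1) * \<i>" by simp
  hence "const (- \<i> / 2) = const (- (1 + 1) * (1/2) * (1/2) * (1/2) * (1 + 1) * \<i>)" by (rule arg_cong)
  moreover have "const (- c) = - const c" for c
    using const_simps(3)[of c "- c"] by (simp add: eq_neg_iff_add_eq_0 add.commute)
  ultimately have "const (- \<i> / 2) = - 2 * h * h * h * (2 * i)"
    unfolding h_def i_def by (simp only: const_simps) simp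
  thus ?thesis
    by (simp only: dQ[OF \<delta>] dQ[OF \<eta>]) (simp only: Q trace_commutator_2x2, simp add: algebra_simps)
qed

section \<open>Derivations of the coordinate ring\<close>

lemma poly3_induct:
  assumes const: "\<And>c. P [:[:[:c:]:]:]" and vars: "P X_poly" "P Y_poly" "P Z_poly"
    and add: "\<And>p q. P p \<Longrightarrow> P q \<Longrightarrow> P (p + q)" and mult: "\<And>p q. P p \<Longrightarrow> P q \<Longrightarrow> P (p * q)"
  shows "P p"
proof (induction p)
  case 0
  show ?case using const[of 0] by simp
next
  case (pCons q p)
  have "P [:[:s:]:]" for s
  proof (induction s)
    case 0
    show ?case using const[of 0] by simp
  next
    case (pCons c s)
    have "[:[:pCons c s:]:] = [:[:[:c:]:]:] + X_poly * [:[:s:]:]"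
      by (simp add: X_poly_def)
    thus ?case using const vars(1) add mult pCons.IH by metis
  qed
  note base = this
  have "P [:r:]" for r
  proof (induction r)
    case 0
    show ?case using const[of 0] by simp
  next
    case (pCons c s)
    have "[:pCons c s:] = [:[:c:]:] + Y_poly * [:s:]"
      by (simp add: Y_poly_def)
    thus ?case using base vars(2) add mult pCons.IH by metis
  qed
  moreover have "pCons q p = [:q:] + Z_poly * p"
    by (simp add: Z_poly_def)
  ultimately show ?case using vars(3) add mult pCons.IH by metis
qed

lemma sphere_ring_induct:
  assumes "\<And>c. P (const c)" "P coord_x" "P coord_y" "P coord_z"
    and "\<And>a b. P a \<Longrightarrow> P b \<Longrightarrow> P (a + b)" "\<And>a b. P a \<Longrightarrow> P b \<Longrightarrow> P (a * b)"
  shows "P a"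
proof (induction a rule: sphere_ring.abs_induct)
  fix p
  show "P (abs_sphere_ring p)"
    by (induction p rule: poly3_induct)
      (simp_all add: assms flip: const.abs_eq coord_x.abs_eq coord_y.abs_eq coord_z.abs_eq
        plus_sphere_ring.abs_eq times_sphere_ring.abs_eq)
qed

lemma derivation_const: "\<delta> \<in> derivations const \<Longrightarrow> \<delta> (const c) = 0"
  using derivation_scale[of \<delta> const c 1] derivation_1[of \<delta> const] by simp

text \<open>
  A derivation is determined by its values on the generators of the algebra. Identities between
  vector fields on the sphere are checked in this way on the three coordinates.
\<close>
lemma derivation_eqI:
  assumes \<delta>: "\<delta> \<in> derivations const" and \<eta>: "\<eta> \<in> derivations const"
    and "\<delta> coord_x = \<eta> coord_x" "\<delta> coord_y = \<eta> coord_y" "\<delta> coord_z = \<eta> coord_z"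
  shows "\<delta> = \<eta>"
proof
  show "\<delta> a = \<eta> a" for a
    by (induction a rule: sphere_ring_induct)
      (simp_all add: assms derivation_const derivation_add[OF \<delta>] derivation_add[OF \<eta>]
        derivation_mult[OF \<delta>] derivation_mult[OF \<eta>])
qed

section \<open>Rotations\<close>

lemma map_poly_add:
  assumes "\<And>a b. d (a + b) = d a + d b" "d 0 = 0"
  shows "map_poly d (p + q) = map_poly d p + map_poly d q"
  by (simp add: poly_eq_iff coeff_map_poly assms)

lemma map_poly_mult_derivation:
  fixes d :: "'a::comm_ring_1 \<Rightarrow> 'a"
  assumes add: "\<And>a b. d (a + b) = d a + d b" and "d 0 = 0" and "\<And>a b. d (a * b) = a * d b + d a * b"
  shows "map_poly d (p * q) = p * map_poly d q + map_poly d p * q"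
proof -
  have "d (sum f S) = (\<Sum>i\<in>S. d (f i))" for f :: "nat \<Rightarrow> 'a" and S
    by (induction S rule: infinite_finite_induct) (simp_all add: assms)
  thus ?thesis
    by (simp add: poly_eq_iff coeff_map_poly coeff_mult assms sum.distrib)
qed

text \<open>
  The vector field \<open>p \<partial>\<^sub>x + q \<partial>\<^sub>y + r \<partial>\<^sub>z\<close>. In the iterated polynomial ring \<open>x\<close> is the innermost variable,
  so \<open>\<partial>\<^sub>x\<close> acts on the coefficients of the coefficients.
\<close>
definition vfield :: "complex poly poly poly \<Rightarrow> complex poly poly poly \<Rightarrow> complex poly poly poly \<Rightarrow>
    complex poly poly poly \<Rightarrow> complex poly poly poly" where
  "vfield p q r f = p * map_poly (map_poly pderiv) f + q * map_poly pderiv f + r * pderiv f"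

lemma vfield_add: "vfield p q r (f + g) = vfield p q r f + vfield p q r g"
  by (simp add: vfield_def map_poly_add pderiv_add algebra_simps)

lemma vfield_mult: "vfield p q r (f * g) = f * vfield p q r g + vfield p q r f * g"
  by (simp add: vfield_def map_poly_mult_derivation map_poly_add pderiv_add pderiv_mult algebra_simps)

lemma vfield_const: "vfield p q r [:[:[:c:]:]:] = 0"
  by (simp add: vfield_def map_poly_pCons)

lemma vfield_vars:
  "vfield p q r X_poly = p" "vfield p q r Y_poly = q" "vfield p q r Z_poly = r"
  by (simp_all add: vfield_def map_poly_pCons X_poly_def Y_poly_def Z_poly_def pderiv_pCons map_poly_1 flip: one_pCons)

definition descend :: "(complex poly poly poly \<Rightarrow> complex poly poly poly) \<Rightarrow> sphere_ring \<Rightarrow> sphere_ring" where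
  "descend d a = abs_sphere_ring (d (rep_sphere_ring a))"

lemma sphere_poly_dvd_rep_abs: "sphere_poly dvd rep_sphere_ring (abs_sphere_ring p) - p"
  using Quotient3_abs_rep[OF Quotient3_sphere_ring, of "abs_sphere_ring p"]
  by (simp add: sphere_ring.abs_eq_iff sphere_rel_def)

lemma abs_rep: "abs_sphere_ring (rep_sphere_ring a) = a"
  by (rule Quotient3_abs_rep[OF Quotient3_sphere_ring])

text \<open>
  A vector field that annihilates the equation of the sphere maps the ideal of the sphere to itself,
  so the choice of representative does not matter.
\<close>
lemma descend_vfield:
  assumes "vfield p q r sphere_poly = 0"
  shows "descend (vfield p q r) (abs_sphere_ring f) = abs_sphere_ring (vfield p q r f)"
proof -
  let ?v = "vfield p q r"
  obtain k where "rep_sphere_ring (abs_sphere_ring f) - f = sphere_poly * k"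
    using sphere_poly_dvd_rep_abs[of f] by (elim dvdE)
  hence "rep_sphere_ring (abs_sphere_ring f) = f + sphere_poly * k"
    by (simp add: algebra_simps)
  hence "sphere_poly dvd ?v (rep_sphere_ring (abs_sphere_ring f)) - ?v f"
    by (simp add: vfield_add vfield_mult assms)
  thus ?thesis
    by (simp add: descend_def sphere_ring.abs_eq_iff sphere_rel_def)
qed

lemma descend_vfield_derivation:
  assumes "vfield p q r sphere_poly = 0"
  shows "descend (vfield p q r) \<in> derivations const"
proof -
  let ?d = "descend (vfield p q r)"
  note d = descend_vfield[OF assms]
  have "?d (a + b) = ?d a + ?d b" "?d (a * b) = a * ?d b + ?d a * b"
    "?d (const c * a) = const c * ?d a" for a b c
  proof -
    obtain f g where "a = abs_sphere_ring f" "b = abs_sphere_ring g"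
      by (metis abs_rep)
    thus "?d (a + b) = ?d a + ?d b" "?d (a * b) = a * ?d b + ?d a * b" "?d (const c * a) = const c * ?d a"
      by (simp_all only: const.abs_eq plus_sphere_ring.abs_eq times_sphere_ring.abs_eq d vfield_add
          vfield_mult vfield_const mult_zero_left add_0_right)
  qed
  thus ?thesis
    unfolding derivations_def Vector_Spaces.linear_iff using vector_space_sphere_ring by blast
qed

definition "rot_x = descend (vfield 0 (- Z_poly) Y_poly)"
definition "rot_y = descend (vfield Z_poly 0 (- X_poly))"
definition "rot_z = descend (vfield (- Y_poly) X_poly 0)"

lemma sphere_poly_sum: "sphere_poly = X_poly * X_poly + Y_poly * Y_poly + Z_poly * Z_poly + - 1"
  by (simp add: sphere_poly_def power2_eq_square)

lemma vfield_minus: "vfield p q r (- f) = - vfield p q r f"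
  using vfield_add[of p q r f "- f"] vfield_const[of p q r 0]
  by (simp add: eq_neg_iff_add_eq_0 add.commute)

text \<open>
  The derivative of the equation of the sphere along a field is twice the scalar product of the field
  with the position vector, so that the fields orthogonal to it are tangent.
\<close>
lemma vfield_sphere_poly: "vfield p q r sphere_poly = 2 * (X_poly * p + Y_poly * q + Z_poly * r)"
proof -
  have "vfield p q r 1 = 0" using vfield_const[of p q r 1] by (simp add: one_pCons)
  hence "vfield p q r sphere_poly = X_poly * p + p * X_poly + (Y_poly * q + q * Y_poly) + (Z_poly * r + r * Z_poly)"
    unfolding sphere_poly_sum vfield_add vfield_mult vfield_vars vfield_minus by simp
  thus ?thesis by (simp add: mult.commute distrib_left mult_2)
qed

lemma rotation_fields:
  "vfield 0 (- Z_poly) Y_poly sphere_poly = 0"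
  "vfield Z_poly 0 (- X_poly) sphere_poly = 0"
  "vfield (- Y_poly) X_poly 0 sphere_poly = 0"
  by (simp_all add: vfield_sphere_poly)

lemma rotations: "rot_x \<in> derivations const" "rot_y \<in> derivations const" "rot_z \<in> derivations const"
  unfolding rot_x_def rot_y_def rot_z_def by (intro descend_vfield_derivation rotation_fields)+

lemma rot_coord:
  "rot_x coord_x = 0" "rot_x coord_y = - coord_z" "rot_x coord_z = coord_y"
  "rot_y coord_x = coord_z" "rot_y coord_y = 0" "rot_y coord_z = - coord_x"
  "rot_z coord_x = - coord_y" "rot_z coord_y = coord_x" "rot_z coord_z = 0"
  by (simp_all add: rot_x_def rot_y_def rot_z_def coord_x.abs_eq coord_y.abs_eq coord_z.abs_eq
    descend_vfield rotation_fields vfield_vars uminus_sphere_ring.abs_eq zero_sphere_ring.abs_eq)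

section \<open>The rotation-invariant functional\<close>

definition coeff_sum :: "(nat \<Rightarrow> 'a::zero \<Rightarrow> complex) \<Rightarrow> 'a poly \<Rightarrow> complex" where
  "coeff_sum f p = (\<Sum>i\<le>degree p. f i (coeff p i))"

lemma coeff_sum_bound:
  assumes "\<And>i. f i 0 = 0" "degree p \<le> n"
  shows "coeff_sum f p = (\<Sum>i\<le>n. f i (coeff p i))"
  unfolding coeff_sum_def
  by (rule sum.mono_neutral_left) (use assms in \<open>auto simp: coeff_eq_0\<close>)

lemma coeff_sum_0: "(\<And>i. f i 0 = 0) \<Longrightarrow> coeff_sum f 0 = 0"
  by (simp add: coeff_sum_def)

lemma coeff_sum_add:
  assumes "\<And>i. f i 0 = 0" "\<And>i a b. f i (a + b) = f i a + f i b"
  shows "coeff_sum f (p + q) = coeff_sum f p + coeff_sum f q"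
proof -
  let ?n = "max (degree p) (degree q)"
  have "degree (p + q) \<le> ?n" by (rule degree_add_le_max)
  thus ?thesis
    using coeff_sum_bound[of f _ ?n] by (simp add: assms sum.distrib)
qed

lemma coeff_sum_monom:
  assumes "\<And>i. f i 0 = 0"
  shows "coeff_sum f (monom a n) = f n a"
proof -
  have "coeff_sum f (monom a n) = (\<Sum>i\<le>n. f i (coeff (monom a n) i))"
    by (rule coeff_sum_bound) (simp_all add: assms degree_monom_le)
  also have "\<dots> = (\<Sum>i\<le>n. if i = n then f n a else 0)"
    by (intro sum.cong) (auto simp: assms)
  finally show ?thesis by simp
qed

text \<open>
  The mean of \<open>x\<^sup>n\<close> under the standard normal distribution: \<open>(n - 1)!!\<close> for even \<open>n\<close>, and \<open>0\<close> for odd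
  \<open>n\<close>.
\<close>
fun gauss_moment :: "nat \<Rightarrow> complex" where
  "gauss_moment 0 = 1" | "gauss_moment (Suc 0) = 0" | "gauss_moment (Suc (Suc n)) = of_nat (Suc n) * gauss_moment n"

text \<open>
  For even \<open>n\<close> this is \<open>(n + 1)!! = 3 \<cdot> 5 \<cdots> (n + 1)\<close>, the mean of the \<open>n\<close>-th power of the length of a standard normal
  vector in three dimensions. The values at odd \<open>n\<close> only ever divide \<open>0\<close>.
\<close>
fun moment_denom :: "nat \<Rightarrow> complex" where
  "moment_denom 0 = 1" | "moment_denom (Suc 0) = 1" | "moment_denom (Suc (Suc n)) = of_nat (n + 3) * moment_denom n"

text \<open>
  The mean of \<open>x\<^sup>a y\<^sup>b z\<^sup>c\<close> over the unit sphere: for a standard normal vector the direction and the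
  length are independent, so the mean of the monomial is the product of its mean over the sphere and
  the moment of the length.
\<close>
definition moment :: "nat \<Rightarrow> nat \<Rightarrow> nat \<Rightarrow> complex" where
  "moment a b c = gauss_moment a * gauss_moment b * gauss_moment c / moment_denom (a + b + c)"

definition poly_mean :: "complex poly poly poly \<Rightarrow> complex" where
  "poly_mean = coeff_sum (\<lambda>c. coeff_sum (\<lambda>b. coeff_sum (\<lambda>a t. t * moment a b c)))"

definition mono3 :: "complex \<Rightarrow> nat \<Rightarrow> nat \<Rightarrow> nat \<Rightarrow> complex poly poly poly" where
  "mono3 t a b c = monom (monom (monom t a) b) c"

lemma poly_mean_0: "poly_mean 0 = 0"
  by (simp add: poly_mean_def coeff_sum_0)

lemma poly_mean_add: "poly_mean (p + q) = poly_mean p + poly_mean q"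
  by (simp add: poly_mean_def coeff_sum_0 coeff_sum_add algebra_simps)

lemma poly_mean_minus: "poly_mean (- p) = - poly_mean p"
  using poly_mean_add[of p "- p"] by (simp add: poly_mean_0 eq_neg_iff_add_eq_0 add.commute)

lemma poly_mean_mono3: "poly_mean (mono3 t a b c) = t * moment a b c"
  by (simp add: poly_mean_def mono3_def coeff_sum_0 coeff_sum_monom)

lemma poly_monom_induct:
  assumes "\<And>a n. P (monom a n)" "\<And>p q. P p \<Longrightarrow> P q \<Longrightarrow> P (p + q)"
  shows "P (p :: 'a::comm_monoid_add poly)"
proof -
  have "P (\<Sum>i\<le>n. monom (coeff p i) i)" for n
    by (induction n) (simp_all add: assms)
  thus ?thesis by (metis poly_as_sum_of_monoms)
qed

lemma mono3_induct:
  assumes mono: "\<And>t a b c. P (mono3 t a b c)" and add: "\<And>p q. P p \<Longrightarrow> P q \<Longrightarrow> P (p + q)"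
  shows "P p"
proof (rule poly_monom_induct)
  fix q c
  have "P (monom (monom r b) c)" for r b
    by (induction r rule: poly_monom_induct)
      (use assms in \<open>simp_all add: mono3_def flip: add_monom\<close>)
  thus "P (monom q c)"
    by (induction q rule: poly_monom_induct) (simp_all add: add flip: add_monom)
qed (rule add)

lemma vars_mult_mono3:
  "X_poly * mono3 t a b c = mono3 t (Suc a) b c"
  "Y_poly * mono3 t a b c = mono3 t a (Suc b) c"
  "Z_poly * mono3 t a b c = mono3 t a b (Suc c)"
  by (simp_all add: mono3_def X_poly_def Y_poly_def Z_poly_def smult_monom monom_Suc)

lemma of_nat_mult_monom: "of_nat n * monom s k = monom (of_nat n * s) k"
  for s :: "'a::comm_ring_1"
  by (simp add: of_nat_monom mult_monom)

lemma vfield_mono3: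
  "vfield p q r (mono3 t a b c) =
    p * mono3 (of_nat a * t) (a - 1) b c + q * mono3 (of_nat b * t) a (b - 1) c + r * mono3 (of_nat c * t) a b (c - 1)"
  by (simp add: vfield_def mono3_def map_poly_monom pderiv_monom of_nat_mult_monom)

lemma of_nat_add_3_nonzero: "of_nat (n + 3) \<noteq> (0::complex)"
  by (simp only: of_nat_eq_0_iff)

text \<open>
  Integration by parts against the normal density. It holds at \<open>n = 0\<close> as well, where the truncated
  \<open>n - 1\<close> is multiplied by \<open>0\<close> and the first moment vanishes.
\<close>
lemma gauss_moment_Suc: "gauss_moment (Suc n) = of_nat n * gauss_moment (n - 1)"
  by (cases n) simp_all

text \<open>
  Multiplication by \<open>x\<^sup>2\<close>, \<open>y\<^sup>2\<close>, \<open>z\<^sup>2\<close> changes the numerator of a moment by the factors \<open>a + 1\<close>,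
  \<open>b + 1\<close>, \<open>c + 1\<close> and the denominator by \<open>a + b + c + 3\<close>, the sum of these factors.
\<close>
lemma poly_mean_sphere: "poly_mean (sphere_poly * p) = 0"
proof (induction p rule: mono3_induct)
  case (1 t a b c)
  have "poly_mean (sphere_poly * mono3 t a b c) =
     t * (moment (Suc (Suc a)) b c + moment a (Suc (Suc b)) c + moment a b (Suc (Suc c)) - moment a b c)"
    by (simp only: sphere_poly_sum distrib_right mult.assoc vars_mult_mono3 mult_minus_left mult_1_left
      poly_mean_add poly_mean_minus poly_mean_mono3) (simp add: right_diff_distrib distrib_left)
  also have "moment (Suc (Suc a)) b c + moment a (Suc (Suc b)) c + moment a b (Suc (Suc c)) = moment a b c"
  proof -
    have num: "of_nat (Suc a) * gauss_moment a * gauss_moment b * gauss_moment c + gauss_moment a * (of_nat (Suc b) * gauss_moment b) * gauss_moment c +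
         gauss_moment a * gauss_moment b * (of_nat (Suc c) * gauss_moment c) = of_nat (a + b + c + 3) * (gauss_moment a * gauss_moment b * gauss_moment c)"
      by (simp add: algebra_simps)
    have "moment (Suc (Suc a)) b c + moment a (Suc (Suc b)) c + moment a b (Suc (Suc c)) =
       (of_nat (Suc a) * gauss_moment a * gauss_moment b * gauss_moment c + gauss_moment a * (of_nat (Suc b) * gauss_moment b) * gauss_moment c +
         gauss_moment a * gauss_moment b * (of_nat (Suc c) * gauss_moment c)) / (of_nat (a + b + c + 3) * moment_denom (a + b + c))"
      by (simp only: moment_def gauss_moment.simps moment_denom.simps add_divide_distrib add_Suc add_Suc_right)
    also have "\<dots> = moment a b c"
      unfolding num moment_def by (rule mult_divide_mult_cancel_left[OF of_nat_add_3_nonzero])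
    finally show ?thesis .
  qed
  finally show ?case by simp
qed (simp add: distrib_left poly_mean_add poly_mean_0)

text \<open>
  These equalities express that the mean value is invariant under infinitesimal rotations: the two
  sides are the contributions of the two terms of a rotation field at a monomial.
\<close>
lemma moment_swap:
  "of_nat a * moment (a - 1) (Suc b) c = of_nat b * moment (Suc a) (b - 1) c"
  "of_nat a * moment (a - 1) b (Suc c) = of_nat c * moment (Suc a) b (c - 1)"
  "of_nat b * moment a (b - 1) (Suc c) = of_nat c * moment a (Suc b) (c - 1)"
  by (cases a; cases b; cases c; simp add: moment_def gauss_moment_Suc)+

lemma poly_mean_rotation:
  "poly_mean (vfield 0 (- Z_poly) Y_poly p) = 0"
  "poly_mean (vfield Z_poly 0 (- X_poly) p) = 0"
  "poly_mean (vfield (- Y_poly) X_poly 0 p) = 0"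
proof -
  note simps = vfield_mono3 mult_zero_left mult_minus_left vars_mult_mono3 poly_mean_add poly_mean_minus
    poly_mean_mono3 add_0_left add_0_right
  have add: "poly_mean (vfield u v w (f + g)) = 0"
    if "poly_mean (vfield u v w f) = 0" "poly_mean (vfield u v w g) = 0" for u v w f g
    using that by (simp add: vfield_add poly_mean_add)
  show "poly_mean (vfield 0 (- Z_poly) Y_poly p) = 0"
    by (induction p rule: mono3_induct)
      (simp only: simps, use moment_swap(3) in \<open>simp add: mult.commute mult.left_commute\<close>, rule add)
  show "poly_mean (vfield Z_poly 0 (- X_poly) p) = 0"
    by (induction p rule: mono3_induct)
      (simp only: simps, use moment_swap(2) in \<open>simp add: mult.commute mult.left_commute\<close>, rule add)
  show "poly_mean (vfield (- Y_poly) X_poly 0 p) = 0"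
    by (induction p rule: mono3_induct)
      (simp only: simps, use moment_swap(1) in \<open>simp add: mult.commute mult.left_commute\<close>, rule add)
qed

definition sphere_mean :: "sphere_ring \<Rightarrow> complex" where
  "sphere_mean a = poly_mean (rep_sphere_ring a)"

lemma sphere_mean_abs: "sphere_mean (abs_sphere_ring p) = poly_mean p"
proof -
  obtain k where "rep_sphere_ring (abs_sphere_ring p) - p = sphere_poly * k"
    using sphere_poly_dvd_rep_abs[of p] by (elim dvdE)
  hence "rep_sphere_ring (abs_sphere_ring p) = p + sphere_poly * k"
    by (simp add: algebra_simps)
  thus ?thesis by (simp add: sphere_mean_def poly_mean_add poly_mean_sphere)
qed

lemma sphere_mean_add: "sphere_mean (a + b) = sphere_mean a + sphere_mean b"
  by (induction a rule: sphere_ring.abs_induct, induction b rule: sphere_ring.abs_induct)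
    (simp add: plus_sphere_ring.abs_eq sphere_mean_abs poly_mean_add)

lemma sphere_mean_const: "sphere_mean (const c) = c"
  using poly_mean_mono3[of c 0 0 0]
  by (simp add: const.abs_eq sphere_mean_abs mono3_def monom_0 moment_def)

lemma sphere_mean_rotation: "sphere_mean (rot_x a) = 0" "sphere_mean (rot_y a) = 0" "sphere_mean (rot_z a) = 0"
  by (induction a rule: sphere_ring.abs_induct,
    simp add: rot_x_def rot_y_def rot_z_def descend_vfield rotation_fields sphere_mean_abs poly_mean_rotation)+

section \<open>Non-exactness of the area form\<close>

lemma trace_conn_mat_add:
  assumes "connection const scale_L D" "\<delta> \<in> derivations const" "\<eta> \<in> derivations const"
  shows "trace (conn_mat D (\<lambda>b. \<delta> b + \<eta> b)) = trace (conn_mat D \<delta>) + trace (conn_mat D \<eta>)"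
  using assms by (simp add: connection_def conn_mat_def trace_def sum_2 plus_L.rep_eq)

lemma trace_conn_mat_smult:
  assumes "connection const scale_L D" "\<delta> \<in> derivations const"
  shows "trace (conn_mat D (\<lambda>b. a * \<delta> b)) = a * trace (conn_mat D \<delta>)"
  using assms by (simp add: connection_def conn_mat_def trace_def sum_2 scale_L.rep_eq distrib_left)

text \<open>
  The rotation fields are tangent to a surface and therefore linearly dependent. The right-hand side
  is the zero derivation, in the form to which linearity of a connection applies.
\<close>
lemma rot_relation:
  "(\<lambda>b. coord_x * rot_x b + (coord_y * rot_y b + coord_z * rot_z b)) = (\<lambda>b. 0 * rot_x b)"
proof (rule derivation_eqI)
  show "(\<lambda>b. coord_x * rot_x b + (coord_y * rot_y b + coord_z * rot_z b)) \<in> derivations const"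
    "(\<lambda>b. 0 * rot_x b) \<in> derivations const"
    by (intro derivations_add derivations_smult rotations)+
qed (simp_all add: rot_coord algebra_simps)

lemma rot_commutators:
  "(\<lambda>a. rot_x (rot_y a) - rot_y (rot_x a)) = (\<lambda>b. - 1 * rot_z b)"
  "(\<lambda>a. rot_y (rot_z a) - rot_z (rot_y a)) = (\<lambda>b. - 1 * rot_x b)"
  "(\<lambda>a. rot_z (rot_x a) - rot_x (rot_z a)) = (\<lambda>b. - 1 * rot_y b)"
proof -
  note intros = commutator_derivation derivations_smult rotations
  note simps = rot_coord rotations[THEN derivation_minus] rotations[THEN derivation_0]
  show "(\<lambda>a. rot_x (rot_y a) - rot_y (rot_x a)) = (\<lambda>b. - 1 * rot_z b)"
    by (rule derivation_eqI, intro intros, intro intros) (simp_all add: simps)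
  show "(\<lambda>a. rot_y (rot_z a) - rot_z (rot_y a)) = (\<lambda>b. - 1 * rot_x b)"
    by (rule derivation_eqI, intro intros, intro intros) (simp_all add: simps)
  show "(\<lambda>a. rot_z (rot_x a) - rot_x (rot_z a)) = (\<lambda>b. - 1 * rot_y b)"
    by (rule derivation_eqI, intro intros, intro intros) (simp_all add: simps)
qed

theorem corollary3p13:
  shows "\<not> (\<exists>D :: (sphere_ring \<Rightarrow> sphere_ring) \<Rightarrow> L \<Rightarrow> L.
             connection const scale_L D \<and> flat const D)"
proof
  assume "\<exists>D :: (sphere_ring \<Rightarrow> sphere_ring) \<Rightarrow> L \<Rightarrow> L. connection const scale_L D \<and> flat const D"
  then obtain D :: "(sphere_ring \<Rightarrow> sphere_ring) \<Rightarrow> L \<Rightarrow> L"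
    where D: "connection const scale_L D" and flat: "flat const D" by blast
  define f where "f \<delta> = trace (conn_mat D \<delta>)" for \<delta>
  define k where "k = const (- \<i> / 2)"
  have f_add: "f (\<lambda>b. \<delta> b + \<eta> b) = f \<delta> + f \<eta>"
    if "\<delta> \<in> derivations const" "\<eta> \<in> derivations const" for \<delta> \<eta>
    using trace_conn_mat_add[OF D that] by (simp add: f_def)
  have f_smult: "f (\<lambda>b. a * \<delta> b) = a * f \<delta>" if "\<delta> \<in> derivations const" for a \<delta>
    using trace_conn_mat_smult[OF D that] by (simp add: f_def)
  have "f (\<lambda>b. coord_x * rot_x b + (coord_y * rot_y b + coord_z * rot_z b)) =
      coord_x * f rot_x + (coord_y * f rot_y + coord_z * f rot_z)"
    by (simp only: f_add f_smult rotations derivations_add derivations_smult)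
  moreover have "f (\<lambda>b. 0 * rot_x b) = 0 * f rot_x"
    by (rule f_smult) (rule rotations)
  ultimately have rel: "coord_x * f rot_x + coord_y * f rot_y + coord_z * f rot_z = 0"
    by (simp only: rot_relation) (simp add: add.assoc)
  have f_minus: "f (\<lambda>b. - \<delta> b) = - f \<delta>" if "\<delta> \<in> derivations const" for \<delta>
    using f_smult[OF that, of "- 1"] by simp
  \<comment> \<open>The determinants of \<open>trace_curvature_proj_mat\<close> at pairs of rotations are coordinates times the
    squared length of the position vector.\<close>
  have s: "coord_x * coord_x + coord_y * coord_y + coord_z * coord_z = 1"
    using sphere_equation by (simp add: power2_eq_square)
  have "rot_x (f rot_y) - rot_y (f rot_x) + f rot_z = k * (coord_z * (coord_x * coord_x + coord_y * coord_y + coord_z * coord_z))"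
    using trace_conn_mat_of_flat[OF D flat rotations(1,2), folded f_def, unfolded trace_curvature_proj_mat[OF rotations(1,2)]]
    by (simp add: rot_commutators f_minus rotations rot_coord k_def algebra_simps)
  hence z: "rot_x (f rot_y) - rot_y (f rot_x) + f rot_z = k * coord_z" by (simp add: s)
  have "rot_y (f rot_z) - rot_z (f rot_y) + f rot_x = k * (coord_x * (coord_x * coord_x + coord_y * coord_y + coord_z * coord_z))"
    using trace_conn_mat_of_flat[OF D flat rotations(2,3), folded f_def, unfolded trace_curvature_proj_mat[OF rotations(2,3)]]
    by (simp add: rot_commutators f_minus rotations rot_coord k_def algebra_simps)
  hence x: "rot_y (f rot_z) - rot_z (f rot_y) + f rot_x = k * coord_x" by (simp add: s)
  have "rot_z (f rot_x) - rot_x (f rot_z) + f rot_y = k * (coord_y * (coord_x * coord_x + coord_y * coord_y + coord_z * coord_z))"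
    using trace_conn_mat_of_flat[OF D flat rotations(3,1), folded f_def, unfolded trace_curvature_proj_mat[OF rotations(3,1)]]
    by (simp add: rot_commutators f_minus rotations rot_coord k_def algebra_simps)
  hence y: "rot_z (f rot_x) - rot_x (f rot_z) + f rot_y = k * coord_y" by (simp add: s)
  have "k = k * (coord_x * coord_x + coord_y * coord_y + coord_z * coord_z)" by (simp add: s)
  also have "\<dots> = coord_x * (k * coord_x) + coord_y * (k * coord_y) + coord_z * (k * coord_z)"
    by (simp add: algebra_simps)
  \<comment> \<open>Pulling the coefficients into the rotations produces, by the Leibniz rule, twice the combination
    of \<open>rel\<close>; one copy is used up by the terms \<open>f rot_x\<close>, \<open>f rot_y\<close>, \<open>f rot_z\<close> that come from the
    commutators, and the other is subtracted explicitly.\<close>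
  also have "\<dots> = rot_x (coord_z * f rot_y - coord_y * f rot_z) + rot_y (coord_x * f rot_z - coord_z * f rot_x)
      + rot_z (coord_y * f rot_x - coord_x * f rot_y)
      - (coord_x * f rot_x + coord_y * f rot_y + coord_z * f rot_z)"
    unfolding x[symmetric] y[symmetric] z[symmetric]
    by (simp add: rotations[THEN derivation_diff] rotations[THEN derivation_mult] rot_coord algebra_simps)
  finally have "k = rot_x (coord_z * f rot_y - coord_y * f rot_z) + rot_y (coord_x * f rot_z - coord_z * f rot_x)
      + rot_z (coord_y * f rot_x - coord_x * f rot_y)"
    by (simp add: rel)
  hence "sphere_mean k = 0"
    by (simp add: sphere_mean_add sphere_mean_rotation)
  thus False by (simp add: k_def sphere_mean_const)
qed

end
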